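(* Let $F=\mathbb{F}_q$ be a finite field, let $m\ge 1$, and let $R=F[x]/\langle x^m-1\rangle$. Let $C\subseteq R^2$ be a quasi-cyclic code of length $2m$ and index $2$, generated by $g_1=(g_{11}(x),g_{12}(x))$ and $g_2=(0,g_{22}(x))$, where $g_{11},g_{12},g_{22}\in F[x]$ satisfy: $g_{11}(x)\mid (x^m-1)$ and $g_{22}(x)\mid (x^m-1)$; $\deg g_{12}(x)<\deg g_{22}(x)$; and $g_{11}(x)g_{22}(x)\mid (x^m-1)g_{12}(x)$. Then $C$ is symplectic self-orthogonal, i.e. $C\subseteq C^{\perp_s}$, if and only if the following conditions hold: 1) $g_{11}(x)g_{22}(x)^\circ\equiv 0\pmod{x^m-1}$; 2) $g_{11}(x)g_{12}(x)^\circ-g_{12}(x)g_{11}(x)^\circ\equiv 0\pmod{x^m-1}$.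
   Context: A quasi-cyclic code of length $2m$ and index $2$ over $F$ (a linear subspace of $F^{2m}$ invariant under the square of the cyclic shift) is identified with an $R$-submodule of $R^2$: a vector $(c_{0,0},c_{0,1},c_{1,0},c_{1,1},\dots,c_{m-1,0},c_{m-1,1})$ corresponds to $(c_0(x),c_1(x))$ with $c_j(x)=\sum_{i=0}^{m-1} c_{i,j}x^i$. "Generated by" means generated as an $R$-module; polynomials are also regarded as elements of $R$ by reduction modulo $x^m-1$. Divisibility is in $F[x]$; convention $\deg 0=-\infty$, so $g_{12}=0$ is allowed. For $f(x)\in F[x]$ with $\deg f\le m$, the transpose polynomial is $f(x)^\circ=x^m f(x^{-1})\in F[x]$. For $a=\sum_{i=0}^{m-1}a_ix^i$, $b=\sum_{i=0}^{m-1}b_ix^i$ in $R$, $\langle a,b\rangle_e=\sum_{i=0}^{m-1}a_ib_i$. The symplectic form on $R^2$ is $\langle (a,b),(a',b')\rangle_s=\langle a,b'\rangle_e-\langle b,a'\rangle_e$, and $C^{\perp_s}=\{u\in R^2: \langle u,v\rangle_s=0 \text{ for all } v\in C\}$. *)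

theory Defs
  imports
    "HOL-Algebra.Algebraic_Closure_Type"
    "HOL-Algebra.QuotRing"
    "HOL-Algebra.Module"
    "HOL-Number_Theory.Cong"
    "Jordan_Normal_Form.Matrix"
begin

text \<open>\<open>F\<close> is a type \<open>'a\<close> of class \<open>{finite, field}\<close>, \<open>F[x]\<close> is the type \<open>'a poly\<close>, and
  \<^const>\<open>ring_of_type_algebra\<close> turns such a type into a ring in the
  sense of HOL-Algebra. Elements of \<open>R = F[x]/(x\<^sup>m - 1)\<close> are cosets, i.e. sets of polynomials.\<close>

definition cyc_modulus :: "nat \<Rightarrow> 'a::field poly" where
  "cyc_modulus m = monom 1 m - 1"

definition cyc_ideal :: "nat \<Rightarrow> 'a::field poly set" where
  "cyc_ideal m = PIdl\<^bsub>ring_of_type_algebra\<^esub> (cyc_modulus m)"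

definition cyc_ring :: "nat \<Rightarrow> 'a::field poly set ring" where
  "cyc_ring m = ring_of_type_algebra Quot cyc_ideal m"

definition cyc_class :: "nat \<Rightarrow> 'a::field poly \<Rightarrow> 'a poly set" where
  "cyc_class m f = cyc_ideal m +>\<^bsub>ring_of_type_algebra\<^esub> f"

text \<open>The representative \<open>a\<^sub>0 + a\<^sub>1 x + \<dots>\<close> with fewer than \<open>m\<close> coefficients of a residue
  class; it exists and is unique for \<open>m \<ge> 1\<close>.\<close>

definition cyc_rep :: "nat \<Rightarrow> 'a::field poly set \<Rightarrow> 'a poly" where
  "cyc_rep m a = (THE p. p \<in> a \<and> degree p < m)"

text \<open>The module \<open>R\<^sup>2\<close>. The record fields \<open>mult\<close> and \<open>one\<close> are irrelevant for modules.\<close>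

definition cyc_module :: "nat \<Rightarrow> ('a::field poly set, 'a poly set \<times> 'a poly set) module" where
  "cyc_module m = \<lparr>
     carrier = carrier (cyc_ring m) \<times> carrier (cyc_ring m),
     monoid.mult = undefined,
     one = undefined,
     zero = (\<zero>\<^bsub>cyc_ring m\<^esub>, \<zero>\<^bsub>cyc_ring m\<^esub>),
     add = (\<lambda>(a, b) (a', b'). (a \<oplus>\<^bsub>cyc_ring m\<^esub> a', b \<oplus>\<^bsub>cyc_ring m\<^esub> b')),
     module.smult = (\<lambda>r (a, b). (r \<otimes>\<^bsub>cyc_ring m\<^esub> a, r \<otimes>\<^bsub>cyc_ring m\<^esub> b))\<rparr>"

definition generated_submodule ::
  "('a, 'b) ring_scheme \<Rightarrow> ('a, 'c, 'd) module_scheme \<Rightarrow> 'c set \<Rightarrow> 'c set" where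
  "generated_submodule R M S = \<Inter>{N. submodule N R M \<and> S \<subseteq> N}"

definition cyclic_shift :: "'a vec \<Rightarrow> 'a vec" where
  "cyclic_shift c = vec (dim_vec c) (\<lambda>i. c $ ((i + dim_vec c - 1) mod dim_vec c))"

definition quasi_cyclic_vecs :: "nat \<Rightarrow> 'a::field vec set \<Rightarrow> bool" where
  "quasi_cyclic_vecs m D \<longleftrightarrow>
     submodule D (ring_of_type_algebra :: 'a ring) (module_vec TYPE('a) (2 * m)) \<and>
     (\<forall>c\<in>D. cyclic_shift (cyclic_shift c) \<in> D)"

text \<open>The coordinate \<open>c\<^bsub>i,j\<^esub>\<close> is the entry with index \<open>2 * i + j\<close> of the vector.\<close>

definition vec_to_pair :: "nat \<Rightarrow> 'a::field vec \<Rightarrow> 'a poly set \<times> 'a poly set" where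
  "vec_to_pair m c =
     (cyc_class m (\<Sum>i<m. monom (c $ (2 * i)) i),
      cyc_class m (\<Sum>i<m. monom (c $ (2 * i + 1)) i))"

definition quasi_cyclic_code :: "nat \<Rightarrow> ('a::field poly set \<times> 'a poly set) set \<Rightarrow> bool" where
  "quasi_cyclic_code m C \<longleftrightarrow> (\<exists>D. quasi_cyclic_vecs m D \<and> C = vec_to_pair m ` D)"

text \<open>\<open>x\<^sup>m f(x\<^sup>-\<^sup>1)\<close>, for \<open>degree f \<le> m\<close>.\<close>

definition transpose_poly :: "nat \<Rightarrow> 'a::field poly \<Rightarrow> 'a poly" where
  "transpose_poly m f = (\<Sum>i\<le>m. monom (coeff f i) (m - i))"

definition inner_e :: "nat \<Rightarrow> 'a::field poly set \<Rightarrow> 'a poly set \<Rightarrow> 'a" where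
  "inner_e m a b = (\<Sum>i<m. coeff (cyc_rep m a) i * coeff (cyc_rep m b) i)"

definition inner_s ::
  "nat \<Rightarrow> 'a::field poly set \<times> 'a poly set \<Rightarrow> 'a poly set \<times> 'a poly set \<Rightarrow> 'a" where
  "inner_s m u v = inner_e m (fst u) (snd v) - inner_e m (snd u) (fst v)"

definition symplectic_dual ::
  "nat \<Rightarrow> ('a::field poly set \<times> 'a poly set) set \<Rightarrow> ('a poly set \<times> 'a poly set) set" where
  "symplectic_dual m C = {u \<in> carrier (cyc_module m). \<forall>v\<in>C. inner_s m u v = 0}"

end

theory Submission
  imports Defs
begin

text \<open>The Euclidean form on \<open>R\<close> is invariant under multiplication of both arguments by \<open>x\<close>, so
  multiplication by \<open>h\<close> has multiplication by the transpose of \<open>h\<close> as its adjoint. Hence the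
  symplectic form of two elements of \<open>C\<close> with coefficients \<open>(r, t)\<close> and \<open>(r', t')\<close> is
  \<open>\<langle>Q r, r'\<rangle> + \<langle>P r, t'\<rangle> - \<langle>P r', t\<rangle>\<close>, where \<open>P\<close> and \<open>Q\<close> are the left-hand sides of the two
  conditions. Nondegeneracy of the Euclidean form then gives the equivalence.\<close>

section \<open>The quotient ring\<close>

lemma ring_of_type_algebra_simps [simp]:
  "carrier ring_of_type_algebra = UNIV"
  "x \<otimes>\<^bsub>ring_of_type_algebra\<^esub> y = x * y"
  "x \<oplus>\<^bsub>ring_of_type_algebra\<^esub> y = x + y"
  "\<one>\<^bsub>ring_of_type_algebra\<^esub> = 1"
  "\<zero>\<^bsub>ring_of_type_algebra\<^esub> = 0"
  by (simp_all add: ring_of_type_algebra_def)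

lemma cyc_ideal_eq: "cyc_ideal m = {h. cyc_modulus m dvd h}"
  by (auto simp: cyc_ideal_def cgenideal_def dvd_def mult.commute)

lemma ideal_cyc_ideal:
  "ideal (cyc_ideal m) (ring_of_type_algebra :: 'a::field poly ring)"
proof -
  interpret cring "ring_of_type_algebra :: 'a poly ring" ..
  show ?thesis
    unfolding cyc_ideal_def by (rule cgenideal_ideal) simp
qed

lemma cyc_class_eq: "cyc_class m f = {h. cyc_modulus m dvd h - f}"
proof -
  have "h \<in> cyc_class m f \<longleftrightarrow> cyc_modulus m dvd h - f" for h
  proof -
    have "h \<in> cyc_class m f \<longleftrightarrow> (\<exists>k. cyc_modulus m dvd k \<and> h = k + f)"
      by (auto simp: cyc_class_def a_r_coset_def' cyc_ideal_eq)
    then show ?thesis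
      by (metis add_diff_cancel_right' diff_add_cancel)
  qed
  then show ?thesis by blast
qed

lemma carrier_cyc_ring: "carrier (cyc_ring m) = range (cyc_class m)"
  by (auto simp: cyc_ring_def FactRing_def A_RCOSETS_def' cyc_class_def)

lemma mult_cyc_ring: "cyc_class m f \<otimes>\<^bsub>cyc_ring m\<^esub> cyc_class m g = cyc_class m (f * g)"
  using ideal.rcoset_mult_add[OF ideal_cyc_ideal, of f g]
  by (simp add: cyc_ring_def FactRing_def cyc_class_def)

lemma add_cyc_ring: "cyc_class m f \<oplus>\<^bsub>cyc_ring m\<^esub> cyc_class m g = cyc_class m (f + g)"
  using ring_hom_add[OF ideal.rcos_ring_hom[OF ideal_cyc_ideal], of f g]
  by (simp add: cyc_ring_def cyc_class_def)

lemma one_cyc_ring: "\<one>\<^bsub>cyc_ring m\<^esub> = cyc_class m 1"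
  by (simp add: cyc_ring_def FactRing_def cyc_class_def)

text \<open>\<open>FactRing\<close> takes the ideal itself as its zero, and the ideal is the coset
  of 0.\<close>

lemma zero_cyc_ring: "\<zero>\<^bsub>cyc_ring m\<^esub> = cyc_class m 0"
  by (simp add: cyc_ring_def FactRing_def cyc_class_eq cyc_ideal_eq)

lemma cring_cyc_ring: "cring (cyc_ring m :: 'a::field poly set ring)"
  unfolding cyc_ring_def
  by (rule ideal.quotient_is_cring[OF ideal_cyc_ideal]) (rule cring_from_type_algebra)

section \<open>The module of pairs and its generated submodules\<close>

lemma cyc_module_simps:
  "carrier (cyc_module m) = range (cyc_class m) \<times> range (cyc_class m)"
  "\<zero>\<^bsub>cyc_module m\<^esub> = (cyc_class m 0, cyc_class m 0)"
  "(cyc_class m a, cyc_class m b) \<oplus>\<^bsub>cyc_module m\<^esub> (cyc_class m c, cyc_class m d) =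
     (cyc_class m (a + c), cyc_class m (b + d))"
  "cyc_class m r \<odot>\<^bsub>cyc_module m\<^esub> (cyc_class m a, cyc_class m b) =
     (cyc_class m (r * a), cyc_class m (r * b))"
  by (simp_all add: cyc_module_def carrier_cyc_ring zero_cyc_ring add_cyc_ring mult_cyc_ring)

text \<open>Once all components are written as \<open>cyc_class m f\<close>, each axiom becomes an
  identity between polynomials.\<close>

lemma module_cyc_module:
  "module (cyc_ring m :: 'a::field poly set ring) (cyc_module m)"
proof (rule moduleI)
  show "cring (cyc_ring m :: 'a poly set ring)"
    by (rule cring_cyc_ring)
  have "\<exists>y\<in>carrier (cyc_module m). y \<oplus>\<^bsub>cyc_module m\<^esub> x = \<zero>\<^bsub>cyc_module m\<^esub>"
    if "x \<in> carrier (cyc_module m)" for x :: "'a poly set \<times> 'a poly set"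
  proof -
    from that obtain f g where x: "x = (cyc_class m f, cyc_class m g)"
      by (auto simp: cyc_module_simps)
    show ?thesis
      by (rule bexI[of _ "(cyc_class m (- f), cyc_class m (- g))"])
        (simp_all add: x cyc_module_simps)
  qed
  then show "abelian_group (cyc_module m :: ('a poly set, _) module)"
    by (intro abelian_groupI) (auto simp: cyc_module_simps add_ac)
qed (auto simp: carrier_cyc_ring cyc_module_simps add_cyc_ring mult_cyc_ring one_cyc_ring
    algebra_simps)

text \<open>Closure under negation comes from scalar closure, since -a = (-1)a.\<close>

lemma (in module) submoduleI':
  assumes "H \<subseteq> carrier M" "\<zero>\<^bsub>M\<^esub> \<in> H"
    and "\<And>a b. \<lbrakk>a \<in> H; b \<in> H\<rbrakk> \<Longrightarrow> a \<oplus>\<^bsub>M\<^esub> b \<in> H"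
    and smult: "\<And>a x. \<lbrakk>a \<in> carrier R; x \<in> H\<rbrakk> \<Longrightarrow> a \<odot>\<^bsub>M\<^esub> x \<in> H"
  shows "submodule H R M"
proof (rule submoduleI)
  fix a assume "a \<in> H"
  moreover from this have "\<ominus>\<^bsub>M\<^esub> a = (\<ominus> \<one>) \<odot>\<^bsub>M\<^esub> a"
    using assms(1) by (auto simp: smult_l_minus)
  ultimately show "\<ominus>\<^bsub>M\<^esub> a \<in> H"
    using smult by simp
qed (use assms in auto)

text \<open>The set of combinations is a submodule containing both generators and lies in every
  other such submodule. Every element of R is the class of a polynomial, so the coefficients r and t
  can range over polynomials; statements about the code then need no cosets.\<close>

lemma generated_submodule_cyc_module:
  fixes a b d :: "'a::field poly"
  shows "generated_submodule (cyc_ring m) (cyc_module m)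
      {(cyc_class m a, cyc_class m b), (cyc_class m 0, cyc_class m d)} =
    {(cyc_class m (r * a), cyc_class m (r * b + t * d)) | r t. True}"
    (is "generated_submodule _ _ ?S = ?N")
proof
  interpret module "cyc_ring m :: 'a poly set ring" "cyc_module m"
    by (rule module_cyc_module)
  have "submodule ?N (cyc_ring m) (cyc_module m)"
  proof (rule submoduleI')
    \<comment> \<open>The witness r = t = 0, left unsimplified so that membership in
      \<open>?N\<close> is a literal match.\<close>
    have "(cyc_class m (0 * a), cyc_class m (0 * b + 0 * d)) \<in> ?N"
      by blast
    then show "\<zero>\<^bsub>cyc_module m\<^esub> \<in> ?N"
      by (simp add: cyc_module_simps)
  next
    fix u v assume "u \<in> ?N" "v \<in> ?N"
    then obtain r t r' t' where
      "u = (cyc_class m (r * a), cyc_class m (r * b + t * d))"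
      "v = (cyc_class m (r' * a), cyc_class m (r' * b + t' * d))"
      by blast
    then have "u \<oplus>\<^bsub>cyc_module m\<^esub> v =
        (cyc_class m ((r + r') * a), cyc_class m ((r + r') * b + (t + t') * d))"
      by (simp add: cyc_module_simps algebra_simps)
    then show "u \<oplus>\<^bsub>cyc_module m\<^esub> v \<in> ?N"
      by blast
  next
    fix s :: "'a poly set" and u assume "s \<in> carrier (cyc_ring m)" "u \<in> ?N"
    then obtain s' r t where
      "s = cyc_class m s'" "u = (cyc_class m (r * a), cyc_class m (r * b + t * d))"
      by (auto simp: carrier_cyc_ring)
    then have "s \<odot>\<^bsub>cyc_module m\<^esub> u =
        (cyc_class m ((s' * r) * a), cyc_class m ((s' * r) * b + (s' * t) * d))"
      by (simp add: cyc_module_simps algebra_simps)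
    then show "s \<odot>\<^bsub>cyc_module m\<^esub> u \<in> ?N"
      by blast
  qed (auto simp: cyc_module_simps)
  moreover have "?S \<subseteq> ?N"
  proof -
    have "(cyc_class m (1 * a), cyc_class m (1 * b + 0 * d)) \<in> ?N"
      "(cyc_class m (0 * a), cyc_class m (0 * b + 1 * d)) \<in> ?N"
      by blast+
    then show ?thesis by simp
  qed
  ultimately show "generated_submodule (cyc_ring m) (cyc_module m) ?S \<subseteq> ?N"
    unfolding generated_submodule_def by blast
next
  interpret module "cyc_ring m :: 'a poly set ring" "cyc_module m"
    by (rule module_cyc_module)
  have "(cyc_class m (r * a), cyc_class m (r * b + t * d)) \<in> N"
    if N: "submodule N (cyc_ring m) (cyc_module m)" "?S \<subseteq> N" for N r t
  proof -
    have "(cyc_class m r \<odot>\<^bsub>cyc_module m\<^esub> (cyc_class m a, cyc_class m b)) \<oplus>\<^bsub>cyc_module m\<^esub>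
        (cyc_class m t \<odot>\<^bsub>cyc_module m\<^esub> (cyc_class m 0, cyc_class m d)) \<in> N"
      using N(2) by (intro submoduleE(4,5)[OF N(1)]) (auto simp: carrier_cyc_ring)
    then show ?thesis
      by (simp add: cyc_module_simps)
  qed
  then show "?N \<subseteq> generated_submodule (cyc_ring m) (cyc_module m) ?S"
    unfolding generated_submodule_def by blast
qed

section \<open>The bilinear form on polynomials\<close>

lemma degree_cyc_modulus [simp]: "m \<ge> 1 \<Longrightarrow> degree (cyc_modulus m) = m"
  unfolding cyc_modulus_def
  by (subst degree_add_eq_left[where q = "- 1", simplified]) (simp_all add: degree_monom_eq)

lemma cyc_modulus_nonzero [simp]: "m \<ge> 1 \<Longrightarrow> cyc_modulus m \<noteq> 0"
  by (metis degree_0 degree_cyc_modulus not_one_le_zero)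

lemma degree_mod_cyc_modulus: "m \<ge> 1 \<Longrightarrow> degree (f mod cyc_modulus m) < m"
  using degree_mod_less[of "cyc_modulus m" f] by auto

text \<open>The remainder lies in the class and has degree below m. It is the only such element,
  because a polynomial of degree below m is its own remainder.\<close>

lemma cyc_rep_cyc_class:
  assumes "m \<ge> 1"
  shows "cyc_rep m (cyc_class m f) = f mod cyc_modulus m"
  unfolding cyc_rep_def
proof (rule the_equality)
  show "f mod cyc_modulus m \<in> cyc_class m f \<and> degree (f mod cyc_modulus m) < m"
    using assms degree_mod_cyc_modulus
    by (simp add: cyc_class_eq mod_eq_dvd_iff[symmetric])
next
  fix p assume "p \<in> cyc_class m f \<and> degree p < m"
  then show "p = f mod cyc_modulus m"
    using assms by (metis cyc_class_eq degree_cyc_modulus mem_Collect_eq mod_eq_dvd_iff mod_poly_less)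
qed

text \<open>The pullback of \<open>inner_e\<close> to polynomials. Reducing both arguments makes it
  depend only on residue classes, and bilinearity follows from linearity of the remainder.\<close>

definition cyc_form :: "nat \<Rightarrow> 'a::field poly \<Rightarrow> 'a poly \<Rightarrow> 'a" where
  "cyc_form m f g = (\<Sum>i<m. coeff (f mod cyc_modulus m) i * coeff (g mod cyc_modulus m) i)"

lemma inner_e_cyc_class:
  "m \<ge> 1 \<Longrightarrow> inner_e m (cyc_class m f) (cyc_class m g) = cyc_form m f g"
  by (simp add: inner_e_def cyc_form_def cyc_rep_cyc_class)

lemma cyc_form_commute: "cyc_form m f g = cyc_form m g f"
  by (simp add: cyc_form_def mult.commute)

lemma cyc_form_cong:
  "[f = f'] (mod cyc_modulus m) \<Longrightarrow> cyc_form m f g = cyc_form m f' g"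
  by (simp add: cyc_form_def cong_def)

lemma cyc_form_add_left: "cyc_form m (f + f') g = cyc_form m f g + cyc_form m f' g"
  by (simp add: cyc_form_def poly_mod_add_left algebra_simps sum.distrib)

lemma cyc_form_diff_left: "cyc_form m (f - f') g = cyc_form m f g - cyc_form m f' g"
  by (simp add: cyc_form_def poly_mod_diff_left algebra_simps sum_subtractf)

lemma cyc_form_0_left [simp]: "cyc_form m 0 g = 0"
  by (simp add: cyc_form_def)

lemma cyc_form_add_right: "cyc_form m f (g + g') = cyc_form m f g + cyc_form m f g'"
  by (metis cyc_form_add_left cyc_form_commute)

lemma cyc_form_0_right [simp]: "cyc_form m f 0 = 0"
  by (simp add: cyc_form_def)

lemma cyc_form_sum_left: "cyc_form m (\<Sum>i\<in>A. f i) g = (\<Sum>i\<in>A. cyc_form m (f i) g)"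
  by (induction A rule: infinite_finite_induct) (simp_all add: cyc_form_add_left)

lemma cyc_form_sum_right: "cyc_form m f (\<Sum>i\<in>A. g i) = (\<Sum>i\<in>A. cyc_form m f (g i))"
  by (simp add: cyc_form_sum_left cyc_form_commute[of m f])

lemma cyc_form_smult_left: "cyc_form m (smult c f) g = c * cyc_form m f g"
  by (simp add: cyc_form_def mod_smult_left sum_distrib_left mult.assoc)

lemma cyc_form_smult_right: "cyc_form m f (smult c g) = c * cyc_form m f g"
  by (metis cyc_form_smult_left cyc_form_commute)

text \<open>\<open>pCons 0 f\<close> is x f. Multiplication by x shifts the coefficients of the
  remainder r up by one, and the leading c = \<open>coeff r (m - 1)\<close> wraps around to the
  constant term.\<close>

lemma pCons_mod_cyc_modulus:
  fixes f :: "'a::field poly"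
  assumes "m \<ge> 1"
  defines "r \<equiv> f mod cyc_modulus m"
  shows "pCons 0 f mod cyc_modulus m =
    pCons (coeff r (m - 1)) r - monom (coeff r (m - 1)) m"
    (is "_ = ?s")
proof -
  have r: "degree r < m"
    unfolding r_def using assms(1) by (rule degree_mod_cyc_modulus)
  \<comment> \<open>c + x r - c x^m equals x r - c (x^m - 1), hence is congruent to x r.\<close>
  have "?s = pCons 0 r - smult (coeff r (m - 1)) (cyc_modulus m)"
    by (rule poly_eqI) (simp add: cyc_modulus_def coeff_pCons split: nat.splits)
  then have "?s mod cyc_modulus m = pCons 0 r mod cyc_modulus m"
    by (simp add: mod_eq_dvd_iff dvd_smult)
  also have "pCons 0 r = monom 1 1 * r"
    by (simp add: monom_Suc monom_0)
  also have "\<dots> mod cyc_modulus m = monom 1 1 * f mod cyc_modulus m"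
    by (simp add: r_def mod_mult_right_eq)
  also have "monom 1 1 * f = pCons 0 f"
    by (simp add: monom_Suc monom_0)
  finally have "pCons 0 f mod cyc_modulus m = ?s mod cyc_modulus m" ..
  \<comment> \<open>The subtracted monomial cancels the coefficient of x^m, so \<open>?s\<close> is
    already reduced.\<close>
  moreover have "degree ?s < m"
  proof (rule degree_lessI)
    show "?s \<noteq> 0 \<or> 0 < m" using assms by simp
    show "\<forall>k\<ge>m. coeff ?s k = 0"
      using r assms(1) by (auto simp: coeff_pCons coeff_eq_0 split: nat.splits)
  qed
  ultimately show ?thesis
    using assms(1) by (simp add: mod_poly_less)
qed

text \<open>Both coefficient sequences undergo the same cyclic rotation, which only permutes the
  summands.\<close>

lemma cyc_form_pCons:
  assumes "m \<ge> 1"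
  shows "cyc_form m (pCons 0 f) (pCons 0 g) = cyc_form m f g"
proof -
  obtain n where m: "m = Suc n"
    using assms by (cases m) auto
  show ?thesis
    unfolding cyc_form_def pCons_mod_cyc_modulus[OF assms]
    \<comment> \<open>The split-off summand at index 0 is the product of the wrapped coefficients,
      that is, the last summand on the right.\<close>
    unfolding m by (subst sum.lessThan_Suc_shift) (simp add: add.commute)
qed

lemma cyc_form_monom_mult:
  assumes "m \<ge> 1"
  shows "cyc_form m (monom 1 k * f) (monom 1 k * g) = cyc_form m f g"
  by (induction k) (simp_all add: monom_Suc cyc_form_pCons[OF assms])

text \<open>Multiplication by \<open>x\<^sup>m\<^sup>-\<^sup>i\<close> on both sides turns the factor \<open>x\<^sup>i\<close> into \<open>x\<^sup>m\<close>, which is \<open>1\<close> in \<open>R\<close>.\<close>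

lemma cyc_form_transpose:
  assumes "m \<ge> 1" and "degree h \<le> m"
  shows "cyc_form m f (h * g) = cyc_form m (transpose_poly m h * f) g"
proof -
  have *: "cyc_form m f (monom 1 i * g) = cyc_form m (monom 1 (m - i) * f) g" if "i \<le> m" for i
  proof -
    have "[monom 1 m = 1] (mod cyc_modulus m)"
      by (simp add: cong_iff_dvd_diff cyc_modulus_def)
    then have "[monom 1 m * g = g] (mod cyc_modulus m)"
      using cong_scalar_right by fastforce
    moreover have "monom 1 (m - i) * (monom 1 i * g) = monom 1 m * g"
      using that by (simp add: mult_monom flip: mult.assoc)
    ultimately show ?thesis
      using cyc_form_monom_mult[OF assms(1), of "m - i" f "monom 1 i * g"]
      by (metis cyc_form_commute cyc_form_cong)
  qed
  have smult: "monom (coeff h i) k * p = smult (coeff h i) (monom 1 k * p)" for i k p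
    by (simp add: smult_monom flip: mult_smult_left)
  \<comment> \<open>The degree bound enters here: the monomials up to x^m recover all of h.\<close>
  have "cyc_form m f (h * g) = cyc_form m f ((\<Sum>i\<le>m. monom (coeff h i) i) * g)"
    by (simp add: poly_as_sum_of_monoms'[OF assms(2)])
  also have "\<dots> = (\<Sum>i\<le>m. cyc_form m f (monom (coeff h i) i * g))"
    by (simp add: sum_distrib_right cyc_form_sum_right)
  also have "\<dots> = (\<Sum>i\<le>m. cyc_form m (monom (coeff h i) (m - i) * f) g)"
    by (rule sum.cong) (simp_all add: smult cyc_form_smult_left cyc_form_smult_right *)
  also have "\<dots> = cyc_form m (transpose_poly m h * f) g"
    by (simp add: transpose_poly_def sum_distrib_right cyc_form_sum_left)
  finally show ?thesis .
qed

text \<open>Nondegeneracy: for k < m the monomial x^k is reduced, so pairing with it reads off the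
  k-th coefficient of the remainder of f.\<close>

lemma cyc_form_eq_0_iff:
  assumes "m \<ge> 1"
  shows "(\<forall>g. cyc_form m f g = 0) \<longleftrightarrow> [f = 0] (mod cyc_modulus m)"
proof
  assume *: "\<forall>g. cyc_form m f g = 0"
  have "coeff (f mod cyc_modulus m) k = 0" for k
  proof (cases "k < m")
    case True
    then have "monom (1::'a) k mod cyc_modulus m = monom 1 k"
      using assms by (intro mod_poly_less) (simp add: degree_monom_eq)
    then have "cyc_form m f (monom 1 k) = coeff (f mod cyc_modulus m) k"
      using True by (simp add: cyc_form_def if_distrib cong: if_cong)
    with * show ?thesis by simp
  next
    case False
    then show ?thesis
      using degree_mod_cyc_modulus[OF assms, of f] by (simp add: coeff_eq_0)
  qed
  then show "[f = 0] (mod cyc_modulus m)"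
    by (simp add: cong_def poly_eq_iff)
qed (simp add: cyc_form_def cong_def)

text \<open>Expand bilinearly and move a, b or d across the form as its transpose. No term contains
  both t and t', because the second generator has first component 0.\<close>

lemma inner_s_generated:
  fixes a b d :: "'a::field poly"
  assumes "m \<ge> 1" "degree a \<le> m" "degree b \<le> m" "degree d \<le> m"
  shows "inner_s m (cyc_class m (r * a), cyc_class m (r * b + t * d))
      (cyc_class m (r' * a), cyc_class m (r' * b + t' * d)) =
    cyc_form m ((a * transpose_poly m b - b * transpose_poly m a) * r) r' +
    cyc_form m (a * transpose_poly m d * r) t' - cyc_form m (a * transpose_poly m d * r') t"
proof -
  note tr = cyc_form_transpose[OF assms(1)]
  have "cyc_form m (r * a) (r' * b) = cyc_form m (a * transpose_poly m b * r) r'"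
    using tr[OF assms(3), of "r * a" r'] by (simp add: ac_simps)
  moreover have "cyc_form m (r * a) (t' * d) = cyc_form m (a * transpose_poly m d * r) t'"
    using tr[OF assms(4), of "r * a" t'] by (simp add: ac_simps)
  moreover have "cyc_form m (r * b) (r' * a) = cyc_form m (b * transpose_poly m a * r) r'"
    using tr[OF assms(2), of "r * b" r'] by (simp add: ac_simps)
  \<comment> \<open>Symmetry of the form is used first, so that d is again the factor transposed and
    the same product with a appears as for t'.\<close>
  moreover have "cyc_form m (t * d) (r' * a) = cyc_form m (a * transpose_poly m d * r') t"
    using tr[OF assms(4), of "r' * a" t] by (simp add: ac_simps cyc_form_commute)
  ultimately show ?thesis
    by (simp add: inner_s_def inner_e_cyc_class[OF assms(1)] cyc_form_add_left cyc_form_add_right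
        cyc_form_diff_left left_diff_distrib)
qed

section \<open>The criterion for self-orthogonality\<close>

theorem theorem5p3:
  fixes m :: nat
    and C :: "('a::{finite, field} poly set \<times> 'a poly set) set"
    and g11 g12 g22 :: "'a poly"
  assumes "m \<ge> 1"
    and "quasi_cyclic_code m C"
    and "C = generated_submodule (cyc_ring m) (cyc_module m)
               {(cyc_class m g11, cyc_class m g12), (cyc_class m 0, cyc_class m g22)}"
    and "g11 dvd cyc_modulus m"
    and "g22 dvd cyc_modulus m"
    and "g12 = 0 \<or> degree g12 < degree g22"
    and "g11 * g22 dvd cyc_modulus m * g12"
  shows "C \<subseteq> symplectic_dual m C \<longleftrightarrow>
           [g11 * transpose_poly m g22 = 0] (mod cyc_modulus m) \<and>
           [g11 * transpose_poly m g12 - g12 * transpose_poly m g11 = 0] (mod cyc_modulus m)"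
proof -
  let ?M = "cyc_modulus m :: 'a poly"
  define P where "P = g11 * transpose_poly m g22"
  define Q where "Q = g11 * transpose_poly m g12 - g12 * transpose_poly m g11"
  \<comment> \<open>The adjoint formula needs degrees at most m. Divisors of the nonzero modulus
    satisfy this, and g12 inherits the bound from g22.\<close>
  have deg: "degree g11 \<le> m" "degree g22 \<le> m"
    using dvd_imp_degree_le[OF assms(4)] dvd_imp_degree_le[OF assms(5)] assms(1) by simp_all
  then have "degree g12 \<le> m"
    using assms(6) by auto
  note inner = inner_s_generated[OF assms(1) deg(1) this deg(2), folded P_def Q_def]
  have C: "C = {(cyc_class m (r * g11), cyc_class m (r * g12 + t * g22)) | r t. True}"
    unfolding assms(3) by (rule generated_submodule_cyc_module)
  \<comment> \<open>Membership in the dual also demands membership in the carrier, so this leaves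
    only the vanishing of the form.\<close>
  have "C \<subseteq> carrier (cyc_module m)"
    by (auto simp: C cyc_module_simps)
  then have "C \<subseteq> symplectic_dual m C \<longleftrightarrow> (\<forall>u\<in>C. \<forall>v\<in>C. inner_s m u v = 0)"
    by (auto simp: symplectic_dual_def)
  also have "\<dots> \<longleftrightarrow> (\<forall>r t r' t'. cyc_form m (Q * r) r' + cyc_form m (P * r) t' -
      cyc_form m (P * r') t = 0)"
    unfolding C inner[symmetric] by blast
  also have "\<dots> \<longleftrightarrow> [P = 0] (mod ?M) \<and> [Q = 0] (mod ?M)"
  proof
    assume *: "\<forall>r t r' t'. cyc_form m (Q * r) r' + cyc_form m (P * r) t' -
      cyc_form m (P * r') t = 0"
    \<comment> \<open>\<open>of\<close> fills the variables in their order of occurrence r, r', t',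
      t. Here r = 1 and r' = t = 0 isolate P; below, r = 1 and t = t' = 0 isolate Q.\<close>
    have "cyc_form m P t' = 0" for t'
      using *[rule_format, of 1 0 t' 0] by simp
    moreover have "cyc_form m Q r' = 0" for r'
      using *[rule_format, of 1 r' 0 0] by simp
    ultimately show "[P = 0] (mod ?M) \<and> [Q = 0] (mod ?M)"
      using cyc_form_eq_0_iff[OF assms(1)] by blast
  next
    \<comment> \<open>Multiples of P and Q also vanish in R, so each of the three terms is
      0.\<close>
    assume "[P = 0] (mod ?M) \<and> [Q = 0] (mod ?M)"
    then have "[P * r = 0] (mod ?M)" "[Q * r = 0] (mod ?M)" for r
      by (auto simp: cong_0_iff)
    then have "cyc_form m (P * r) g = 0" "cyc_form m (Q * r) g = 0" for r g
      using cyc_form_eq_0_iff[OF assms(1)] by blast+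
    then show "\<forall>r t r' t'. cyc_form m (Q * r) r' + cyc_form m (P * r) t' -
      cyc_form m (P * r') t = 0"
      by simp
  qed
  finally show ?thesis
    unfolding P_def Q_def .
qed

end
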